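(* Let $\phi\in L^2(\mathbb{R})$ satisfy $0<C_\phi=\int_{\mathbb{R}}\frac{|\hat\phi(\omega)|^2}{|\omega|}\,d\omega<\infty$. (i) Let $p,q>1$ and $0<\rho<1$ with $\frac1p+\frac1q=1+\rho$, and let $\psi\in L^p(\mathbb{R})$, $\phi\in L^1(\mathbb{R})$, $\chi\in L^q(\mathbb{R})$. Then for all $v\neq w$ in $\mathbb{R}$, $$\int_{\mathbb{R}}|D^\alpha(u,v,w)|\,du\le C_\phi^{-1}\,C(p,\rho)\,|v-w|^{-\rho}\,\|\psi\|_p\,\|\phi\|_1\,\|\chi\|_q ,$$ where $C(p,\rho)$ is a constant depending only on $p$ and $\rho$. (ii) Let $\rho\ge 1$, $\phi\in L^1(\mathbb{R})$, $(1+|x|^{\rho-1})\chi(x)\in L^1(\mathbb{R})$ and $(1+|x|^{\rho-1})\psi(x)\in L^1(\mathbb{R})$. Then for all $v\neq w$ in $\mathbb{R}$, $$\int_{\mathbb{R}}|D^\alpha(u,v,w)|\,du\le C_\phi^{-1}\,2^{\rho-1}\,|v-w|^{-\rho}\Big[\big\|\psi(x)|x|^{\rho-1}\big\|_1\|\chi\|_1+\big\|\chi(x)|x|^{\rho-1}\big\|_1\|\psi\|_1\Big]\|\phi\|_1 .$$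
   Context: Let $\theta=\alpha\pi/2$ with $\sin\theta\ne 0$. For a function $f$ on $\mathbb{R}$ (with $f=\phi,\psi,\chi$), $a\in\mathbb{R}\setminus\{0\}$, $b\in\mathbb{R}$, put $$f^{\alpha}_{a,b}(t)=e^{-\frac{i}{2}(t^2-b^2)\cot\theta}\,|a|^{-\rho}\,f\!\left(\frac{t-b}{a}\right).$$ The basic function associated with $(\phi,\psi,\chi)$ is $$D^\alpha(u,v,w)=C_\phi^{-1}\int_{\mathbb{R}}\int_{\mathbb{R}}\overline{\psi^\alpha_{a,b}(w)}\;\overline{\chi^\alpha_{a,b}(v)}\;\phi^\alpha_{a,b}(u)\,|a|^{2\rho-3}\,da\,db .$$ The Fourier transform is $\hat\phi(\omega)=\int_{\mathbb{R}}\phi(t)e^{-i\omega t}\,dt$. *)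

theory Defs
  imports "HOL-Analysis.Analysis"
begin

text \<open>
  Functions on the line are represented by Lebesgue measurable representatives
  of type \<^typ>\<open>real \<Rightarrow> complex\<close>; the exponent \<open>p\<close> is finite.
  The third function of the triple \<open>(\<phi>, \<psi>, \<eta>)\<close> is usually called chi, a symbol that is reserved here
  as the binder for vectors.
\<close>

definition in_Lp :: "real \<Rightarrow> (real \<Rightarrow> complex) \<Rightarrow> bool" where
  "in_Lp p f \<longleftrightarrow>
     f \<in> borel_measurable lebesgue \<and> integrable lebesgue (\<lambda>x. cmod (f x) powr p)"

definition Lp_norm :: "real \<Rightarrow> (real \<Rightarrow> complex) \<Rightarrow> real" where
  "Lp_norm p f = (\<integral>x. cmod (f x) powr p \<partial>lebesgue) powr (1 / p)"

text \<open>
  The integral formula represents the Fourier transform for integrable functions only;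
  it has no meaning for a function that is merely square integrable.
\<close>

definition fourier :: "(real \<Rightarrow> complex) \<Rightarrow> real \<Rightarrow> complex" where
  "fourier f \<omega> = (\<integral>t. f t * exp (- \<i> * complex_of_real (\<omega> * t)) \<partial>lebesgue)"

definition adm_const :: "(real \<Rightarrow> complex) \<Rightarrow> real" where
  "adm_const \<phi> = (\<integral>\<omega>. (cmod (fourier \<phi> \<omega>))\<^sup>2 / \<bar>\<omega>\<bar> \<partial>lebesgue)"

text \<open>
  At the excluded scale \<open>a = 0\<close> the dilated function is \<open>0\<close>, since \<open>0 powr x = 0\<close>;
  the line \<open>a = 0\<close> is a null set in the integrals below.
\<close>

definition frac_dilate ::
    "real \<Rightarrow> real \<Rightarrow> (real \<Rightarrow> complex) \<Rightarrow> real \<Rightarrow> real \<Rightarrow> real \<Rightarrow> complex" where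
  "frac_dilate \<alpha> \<rho> f a b t =
     exp (- (\<i> / 2) * complex_of_real ((t\<^sup>2 - b\<^sup>2) * cot (\<alpha> * pi / 2)))
       * complex_of_real (\<bar>a\<bar> powr (- \<rho>)) * f ((t - b) / a)"

definition basic_integrand ::
    "real \<Rightarrow> real \<Rightarrow> (real \<Rightarrow> complex) \<Rightarrow> (real \<Rightarrow> complex) \<Rightarrow> (real \<Rightarrow> complex)
       \<Rightarrow> real \<Rightarrow> real \<Rightarrow> real \<Rightarrow> real \<Rightarrow> real \<Rightarrow> complex" where
  "basic_integrand \<alpha> \<rho> \<phi> \<psi> \<eta> u v w a b =
     cnj (frac_dilate \<alpha> \<rho> \<psi> a b w) * cnj (frac_dilate \<alpha> \<rho> \<eta> a b v)
       * frac_dilate \<alpha> \<rho> \<phi> a b u * complex_of_real (\<bar>a\<bar> powr (2 * \<rho> - 3))"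

definition basic_fun ::
    "real \<Rightarrow> real \<Rightarrow> (real \<Rightarrow> complex) \<Rightarrow> (real \<Rightarrow> complex) \<Rightarrow> (real \<Rightarrow> complex)
       \<Rightarrow> real \<Rightarrow> real \<Rightarrow> real \<Rightarrow> complex" where
  "basic_fun \<alpha> \<rho> \<phi> \<psi> \<eta> u v w =
     complex_of_real (inverse (adm_const \<phi>))
       * (\<integral>b. (\<integral>a. basic_integrand \<alpha> \<rho> \<phi> \<psi> \<eta> u v w a b \<partial>lebesgue) \<partial>lebesgue)"

text \<open>
  The value of \<^const>\<open>basic_fun\<close> is meaningful where its integrand is absolutely
  integrable over the plane. Bochner integrals of non-integrable functions are \<open>0\<close>, so a bound
  on the \<open>L\<^sup>1\<close> norm in \<open>u\<close> is stated together with the integrability that gives it content: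
  the defining integral converges absolutely for almost every \<open>u\<close>, and the resulting function of
  \<open>u\<close> is integrable.
\<close>

definition basic_fun_L1_bound ::
    "real \<Rightarrow> real \<Rightarrow> (real \<Rightarrow> complex) \<Rightarrow> (real \<Rightarrow> complex) \<Rightarrow> (real \<Rightarrow> complex)
       \<Rightarrow> real \<Rightarrow> real \<Rightarrow> real \<Rightarrow> bool" where
  "basic_fun_L1_bound \<alpha> \<rho> \<phi> \<psi> \<eta> v w B \<longleftrightarrow>
     (AE u in lebesgue.
        integrable (lebesgue :: (real \<times> real) measure)
          (\<lambda>(a, b). basic_integrand \<alpha> \<rho> \<phi> \<psi> \<eta> u v w a b)) \<and>
     integrable lebesgue (\<lambda>u. basic_fun \<alpha> \<rho> \<phi> \<psi> \<eta> u v w) \<and>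
     (\<integral>u. cmod (basic_fun \<alpha> \<rho> \<phi> \<psi> \<eta> u v w) \<partial>lebesgue) \<le> B"

end

theory Submission
  imports Defs
begin

text \<open>
  Integrating the modulus of the integrand over \<open>u\<close> first produces the factor \<open>\<bar>a\<bar> * \<parallel>\<phi>\<parallel>\<close>. The substitution
  \<open>x = (w - b) / a\<close>, \<open>y = (v - b) / a\<close>, under which \<open>a = (w - v) / (x - y)\<close>, turns the remaining integral over
  \<open>(a, b)\<close> into \<open>\<bar>v - w\<bar> powr (- \<rho>)\<close> times \<open>\<integral>\<integral> \<bar>\<psi> x\<bar> \<bar>\<eta> y\<bar> \<bar>x - y\<bar> powr (\<rho> - 1)\<close>. For \<open>\<rho> \<ge> 1\<close> this is bounded by
  \<open>\<bar>x - y\<bar> powr s \<le> 2 powr s * (\<bar>x\<bar> powr s + \<bar>y\<bar> powr s)\<close>, and for \<open>\<rho> < 1\<close> it is the one-dimensional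
  Hardy--Littlewood--Sobolev inequality.

  The latter has an elementary proof for the densities \<open>F = \<bar>\<psi>\<bar> powr p\<close>, \<open>G = \<bar>\<eta>\<bar> powr q\<close> of total mass \<open>1\<close>. Where
  \<open>G y \<le> F x\<close>, split according to whether \<open>\<bar>x - y\<bar> \<le> 1 / F x\<close>: the near part is estimated by \<open>G y \<le> F x\<close>, the
  far part by Young's inequality. Either way the integrand is at most \<open>F x\<close> times a function of \<open>y\<close> whose integral
  is bounded independently of \<open>x\<close>. The region \<open>F x \<le> G y\<close> is symmetric.

  Lebesgue measurable functions are exchanged for Borel representatives before Tonelli's theorem is applied.
\<close>

section \<open>The one-dimensional Hardy--Littlewood--Sobolev inequality\<close>

text \<open>The kernel majorant left after a factor \<open>s = F x\<close> is taken out, with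
  \<open>z = x - y\<close>: the first branch is the near part, the second the far part that comes
  from Young's inequality. The powers of \<open>s\<close> are chosen so that the integral of each
  branch over \<open>z\<close> does not depend on \<open>s > 0\<close>.\<close>

definition hls_kernel :: "real \<Rightarrow> real \<Rightarrow> real \<Rightarrow> real \<Rightarrow> real" where
  "hls_kernel \<rho> \<mu> s z =
     (if \<bar>z\<bar> \<le> 1 / s then s powr \<rho> * \<bar>z\<bar> powr (\<rho> - 1) else s powr (1 - \<mu>) * \<bar>z\<bar> powr (- \<mu>))"

lemma hls_kernel_nonneg: "0 \<le> hls_kernel \<rho> \<mu> s z"
  by (simp add: hls_kernel_def)

lemma borel_measurable_hls_kernel [measurable]:
  assumes [measurable]: "f \<in> borel_measurable M" "g \<in> borel_measurable M"
  shows "(\<lambda>x. hls_kernel \<rho> \<mu> (f x) (g x)) \<in> borel_measurable M"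
  unfolding hls_kernel_def by measurable

lemma nn_integral_even:
  fixes f :: "real \<Rightarrow> ennreal"
  assumes [measurable]: "f \<in> borel_measurable borel" and even: "\<And>x. f (- x) = f x"
  shows "(\<integral>\<^sup>+x. f x \<partial>lborel) = 2 * (\<integral>\<^sup>+x. f x * indicator {0..} x \<partial>lborel)"
proof -
  have "(\<integral>\<^sup>+x. f x \<partial>lborel) = (\<integral>\<^sup>+x. f x * indicator {0..} x + f x * indicator {..0} x \<partial>lborel)"
    using AE_lborel_singleton[of "0::real"]
    by (intro nn_integral_cong_AE) (auto elim!: eventually_mono simp: indicator_def)
  also have "\<dots> = (\<integral>\<^sup>+x. f x * indicator {0..} x \<partial>lborel) + (\<integral>\<^sup>+x. f x * indicator {..0} x \<partial>lborel)"
    by (intro nn_integral_add) auto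
  also have "(\<integral>\<^sup>+x. f x * indicator {..0} x \<partial>lborel) = (\<integral>\<^sup>+x. f x * indicator {0..} x \<partial>lborel)"
    by (subst nn_integral_real_affine[where c = "-1" and t = 0])
       (auto simp: even indicator_def intro!: nn_integral_cong)
  finally show ?thesis
    by (simp add: mult_2)
qed

text \<open>The powers of \<open>s\<close> cancel, as the scaling \<open>z = r / s\<close> predicts.
  On each half-line the near branch contributes \<open>1 / \<rho>\<close>, finite since
  \<open>\<rho> > 0\<close>, and the far branch \<open>1 / (\<mu> - 1)\<close>, finite since
  \<open>\<mu> > 1\<close>.\<close>

lemma nn_integral_hls_kernel_le:
  assumes "0 < \<rho>" "1 < \<mu>" "0 \<le> s"
  shows "(\<integral>\<^sup>+z. hls_kernel \<rho> \<mu> s z \<partial>lborel) \<le> ennreal (2 / \<rho> + 2 / (\<mu> - 1))"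
proof (cases "s = 0")
  case True
  \<comment> \<open>Both branches carry a power of \<open>s\<close>, and \<open>0 powr x = 0\<close>
    for every \<open>x\<close>.\<close>
  then have "hls_kernel \<rho> \<mu> s z = 0" for z
    by (auto simp: hls_kernel_def)
  then show ?thesis by simp
next
  case False
  with assms have s: "0 < s" by simp
  let ?R = "1 / s"
  have half: "(\<integral>\<^sup>+z. hls_kernel \<rho> \<mu> s z \<partial>lborel)
      = 2 * (\<integral>\<^sup>+z. ennreal (hls_kernel \<rho> \<mu> s z) * indicator {0..} z \<partial>lborel)"
    by (subst nn_integral_even) (auto simp: hls_kernel_def)
  \<comment> \<open>Only an inequality is claimed, because the two closed ranges overlap at
    \<open>z = ?R\<close>.\<close>
  have "(\<integral>\<^sup>+z. ennreal (hls_kernel \<rho> \<mu> s z) * indicator {0..} z \<partial>lborel)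
      \<le> (\<integral>\<^sup>+z. ennreal (s powr \<rho>) * (ennreal (z powr (\<rho> - 1)) * indicator {0..?R} z)
           + ennreal (s powr (1 - \<mu>)) * (ennreal (z powr (- \<mu>)) * indicator {?R..} z) \<partial>lborel)"
  proof (intro nn_integral_mono)
    fix z
    consider "z < 0" | "0 \<le> z" "z \<le> ?R" | "?R < z" "0 \<le> z" using s by linarith
    then show "ennreal (hls_kernel \<rho> \<mu> s z) * indicator {0..} z
      \<le> ennreal (s powr \<rho>) * (ennreal (z powr (\<rho> - 1)) * indicator {0..?R} z)
           + ennreal (s powr (1 - \<mu>)) * (ennreal (z powr (- \<mu>)) * indicator {?R..} z)"
    proof cases
      case 2
      then have "hls_kernel \<rho> \<mu> s z = s powr \<rho> * z powr (\<rho> - 1)" by (simp add: hls_kernel_def)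
      then show ?thesis using 2 by (simp del: le_divide_eq_1 add: ennreal_mult)
    next
      case 3
      then have "hls_kernel \<rho> \<mu> s z = s powr (1 - \<mu>) * z powr (- \<mu>)" by (simp add: hls_kernel_def)
      then show ?thesis using 3 by (simp add: ennreal_mult)
    qed simp
  qed
  also have "\<dots> = ennreal (s powr \<rho>) * (\<integral>\<^sup>+z. ennreal (z powr (\<rho> - 1)) * indicator {0..?R} z \<partial>lborel)
           + ennreal (s powr (1 - \<mu>)) * (\<integral>\<^sup>+z. ennreal (z powr (- \<mu>)) * indicator {?R..} z \<partial>lborel)"
    by (simp add: nn_integral_add nn_integral_cmult)
  also have "(\<integral>\<^sup>+z. ennreal (z powr (\<rho> - 1)) * indicator {0..?R} z \<partial>lborel) = ennreal (?R powr \<rho> / \<rho>)"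
    using has_integral_powr_from_0[of "\<rho> - 1" ?R] assms s
    by (intro nn_integral_has_integral_lebesgue') auto
  also have "(\<integral>\<^sup>+z. ennreal (z powr (- \<mu>)) * indicator {?R..} z \<partial>lborel)
      = ennreal (- (?R powr (- \<mu> + 1)) / (- \<mu> + 1))"
    using has_integral_powr_to_inf[of "- \<mu>" ?R] assms s
    by (intro nn_integral_has_integral_lebesgue') auto
  also have "- (?R powr (- \<mu> + 1)) / (- \<mu> + 1) = s powr (\<mu> - 1) / (\<mu> - 1)"
    using s assms by (simp add: powr_divide powr_minus field_simps powr_diff powr_add)
  also have "ennreal (s powr \<rho>) * ennreal (?R powr \<rho> / \<rho>)
      + ennreal (s powr (1 - \<mu>)) * ennreal (s powr (\<mu> - 1) / (\<mu> - 1)) = ennreal (1 / \<rho> + 1 / (\<mu> - 1))"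
  proof -
    have "s powr \<rho> * (?R powr \<rho> / \<rho>) = 1 / \<rho>" using s by (simp add: powr_divide)
    moreover have "s powr (1 - \<mu>) * (s powr (\<mu> - 1) / (\<mu> - 1)) = 1 / (\<mu> - 1)"
      using s by (simp flip: powr_add)
    ultimately show ?thesis using assms by (simp flip: ennreal_mult ennreal_plus)
  qed
  finally have "(\<integral>\<^sup>+z. ennreal (hls_kernel \<rho> \<mu> s z) * indicator {0..} z \<partial>lborel) \<le> ennreal (1 / \<rho> + 1 / (\<mu> - 1))" .
  then have "(\<integral>\<^sup>+z. hls_kernel \<rho> \<mu> s z \<partial>lborel) \<le> 2 * ennreal (1 / \<rho> + 1 / (\<mu> - 1))"
    unfolding half by (rule mult_left_mono) simp
  also have "\<dots> = ennreal (2 * (1 / \<rho> + 1 / (\<mu> - 1)))"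
    using assms by (subst ennreal_mult) auto
  finally show ?thesis
    by (simp add: algebra_simps)
qed

text \<open>Here \<open>q / (q - 1)\<close> is conjugate to \<open>q\<close>, and the product is the
  decay exponent \<open>\<mu>\<close> of the far branch. Since \<open>p > 1\<close>, the exponent
  relation gives \<open>\<rho> < 1 / q\<close>, which is equivalent to \<open>\<mu> > 1\<close>,
  that is, to integrability at infinity.\<close>

lemma conj_exponent_scaled_gt_1:
  fixes p q \<rho> :: real
  assumes "1 < p" "1 < q" "1 / p + 1 / q = 1 + \<rho>"
  shows "1 < (1 - \<rho>) * (q / (q - 1))"
proof -
  have "1 / p < 1" using assms by simp
  then have "\<rho> < 1 / q" using assms by linarith
  then have "\<rho> * q < 1" using assms by (simp add: field_simps)
  then show ?thesis using assms by (simp add: field_simps)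
qed

text \<open>Used with \<open>s\<close> the larger and \<open>t\<close> the smaller of the two
  density values. In the near part \<open>t\<close> may be replaced by \<open>s\<close>, since the
  exponents then sum to \<open>1 + \<rho>\<close>; in the far part Young's inequality with exponents
  \<open>q\<close> and \<open>q / (q - 1)\<close> isolates \<open>t\<close> to the first
  power.\<close>

lemma hls_pointwise:
  fixes p q \<rho> s t z :: real
  assumes pq: "1 < p" "1 < q" "1 / p + 1 / q = 1 + \<rho>" and t: "0 \<le> t" "t \<le> s"
  shows "s powr (1 / p) * t powr (1 / q) * \<bar>z\<bar> powr (\<rho> - 1)
    \<le> s * (t + hls_kernel \<rho> ((1 - \<rho>) * (q / (q - 1))) s z)"
proof (cases "s = 0")
  case False
  with t have s: "0 < s" by simp
  let ?q' = "q / (q - 1)"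
  show ?thesis
  proof (cases "\<bar>z\<bar> \<le> 1 / s")
    case True
    have "s powr (1 / p) * t powr (1 / q) \<le> s powr (1 / p) * s powr (1 / q)"
      using t pq by (intro mult_left_mono powr_mono2) auto
    also have "\<dots> = s * s powr \<rho>"
      using s pq(3) by (simp add: powr_add[of s 1 \<rho>] flip: powr_add)
    finally have "s powr (1 / p) * t powr (1 / q) * \<bar>z\<bar> powr (\<rho> - 1) \<le> s * s powr \<rho> * \<bar>z\<bar> powr (\<rho> - 1)"
      by (rule mult_right_mono) simp
    also have "\<dots> \<le> s * (t + s powr \<rho> * \<bar>z\<bar> powr (\<rho> - 1))"
      using s t by (simp add: algebra_simps)
    finally show ?thesis using True by (simp add: hls_kernel_def)
  next
    case False
    have q': "1 < ?q'" "1 / q + 1 / ?q' = 1" using pq by (auto simp: field_simps)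
    \<comment> \<open>\<open>?B\<close> is the cofactor of \<open>t powr (1 / q)\<close> once
      \<open>s\<close> has been taken out, so the exponent of \<open>s\<close> drops to
      \<open>1 / p - 1\<close>.\<close>
    let ?B = "s powr (1 / p - 1) * \<bar>z\<bar> powr (\<rho> - 1)"
    have "t powr (1 / q) * ?B \<le> (t powr (1 / q)) powr q / q + ?B powr ?q' / ?q'"
      using q' pq by (intro Youngs_inequality) auto
    also have "\<dots> \<le> (t powr (1 / q)) powr q + ?B powr ?q'"
      using divide_left_mono[of 1 q "(t powr (1 / q)) powr q"]
        divide_left_mono[of 1 ?q' "?B powr ?q'"] q'(1) pq by (intro add_mono) (simp_all del: divide_divide_eq_right)
    also have "(t powr (1 / q)) powr q = t"
      using t pq by (simp add: powr_powr)
    also have "?B powr ?q' = s powr ((1 / p - 1) * ?q') * \<bar>z\<bar> powr ((\<rho> - 1) * ?q')"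
      by (simp only: powr_mult powr_powr powr_ge_zero abs_ge_zero)
    \<comment> \<open>The exponent relation enters here: it turns the \<open>?q'\<close>-th power of
      \<open>?B\<close> into the far branch of \<open>hls_kernel\<close> with
      \<open>\<mu> = (1 - \<rho>) * ?q'\<close>.\<close>
    also have "(1 / p - 1) * ?q' = 1 - (1 - \<rho>) * ?q'"
    proof -
      have "1 / p - 1 = \<rho> - 1 / q" using pq by simp
      moreover have "(\<rho> - 1 / q) * ?q' = 1 - (1 - \<rho>) * ?q'" using pq(2) by (simp add: divide_simps) (simp add: algebra_simps)
      ultimately show ?thesis by simp
    qed
    also have "(\<rho> - 1) * ?q' = - ((1 - \<rho>) * ?q')" by (metis minus_diff_eq mult_minus_left)
    finally have "s * (t powr (1 / q) * ?B) \<le> s * (t + hls_kernel \<rho> ((1 - \<rho>) * ?q') s z)"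
      using False s by (simp add: hls_kernel_def)
    moreover have "s * (t powr (1 / q) * ?B) = s powr (1 / p) * t powr (1 / q) * \<bar>z\<bar> powr (\<rho> - 1)"
      using s by (simp add: powr_diff)
    ultimately show ?thesis by simp
  qed
qed (use t in auto)

text \<open>
  The pointwise bound of \<open>hls_pointwise\<close> costs \<open>1 + 2 / \<rho> + 2 / (\<mu> - 1)\<close> after integration, once for
  each ordering of the two densities.
\<close>

definition hls_const :: "real \<Rightarrow> real \<Rightarrow> real \<Rightarrow> real" where
  "hls_const p q \<rho> = 2 + 4 / \<rho> + 2 / ((1 - \<rho>) * (q / (q - 1)) - 1) + 2 / ((1 - \<rho>) * (p / (p - 1)) - 1)"

text \<open>For fixed \<open>x\<close> the mass of \<open>G\<close> contributes at most
  \<open>1\<close>, and the kernel integral is bounded uniformly in the value \<open>F x\<close>.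
  The remaining factor \<open>F x\<close> is integrated last.\<close>

lemma hardy_littlewood_sobolev_half:
  fixes F G :: "real \<Rightarrow> real"
  assumes [measurable]: "F \<in> borel_measurable borel" "G \<in> borel_measurable borel"
    and F: "\<And>x. 0 \<le> F x" "(\<integral>\<^sup>+x. F x \<partial>lborel) \<le> 1"
    and G: "\<And>x. 0 \<le> G x" "(\<integral>\<^sup>+x. G x \<partial>lborel) \<le> 1"
    and "0 < \<rho>" "1 < \<mu>"
  shows "(\<integral>\<^sup>+x. \<integral>\<^sup>+y. F x * (G y + hls_kernel \<rho> \<mu> (F x) (x - y)) \<partial>lborel \<partial>lborel)
    \<le> ennreal (1 + (2 / \<rho> + 2 / (\<mu> - 1)))"
proof -
  have "(\<integral>\<^sup>+y. F x * (G y + hls_kernel \<rho> \<mu> (F x) (x - y)) \<partial>lborel)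
      \<le> ennreal (F x) * ennreal (1 + (2 / \<rho> + 2 / (\<mu> - 1)))" for x
  proof -
    have "(\<integral>\<^sup>+y. F x * (G y + hls_kernel \<rho> \<mu> (F x) (x - y)) \<partial>lborel)
        = (\<integral>\<^sup>+y. ennreal (F x) * (ennreal (G y) + ennreal (hls_kernel \<rho> \<mu> (F x) (x - y))) \<partial>lborel)"
      by (intro nn_integral_cong) (simp add: F G hls_kernel_nonneg ennreal_mult)
    also have "\<dots> = ennreal (F x) * ((\<integral>\<^sup>+y. G y \<partial>lborel) + (\<integral>\<^sup>+y. hls_kernel \<rho> \<mu> (F x) (x - y) \<partial>lborel))"
      by (simp add: nn_integral_cmult nn_integral_add)
    also have "(\<integral>\<^sup>+y. hls_kernel \<rho> \<mu> (F x) (x - y) \<partial>lborel) = (\<integral>\<^sup>+z. hls_kernel \<rho> \<mu> (F x) z \<partial>lborel)"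
      by (subst (2) nn_integral_real_affine[where c = "-1" and t = x]) auto
    also have "ennreal (F x) * ((\<integral>\<^sup>+y. G y \<partial>lborel) + (\<integral>\<^sup>+z. hls_kernel \<rho> \<mu> (F x) z \<partial>lborel))
        \<le> ennreal (F x) * (1 + ennreal (2 / \<rho> + 2 / (\<mu> - 1)))"
      using assms by (intro mult_left_mono add_mono nn_integral_hls_kernel_le) auto
    finally show ?thesis using assms by simp
  qed
  then have "(\<integral>\<^sup>+x. \<integral>\<^sup>+y. F x * (G y + hls_kernel \<rho> \<mu> (F x) (x - y)) \<partial>lborel \<partial>lborel)
      \<le> (\<integral>\<^sup>+x. ennreal (F x) * ennreal (1 + (2 / \<rho> + 2 / (\<mu> - 1))) \<partial>lborel)"
    by (intro nn_integral_mono)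
  also have "\<dots> = (\<integral>\<^sup>+x. F x \<partial>lborel) * ennreal (1 + (2 / \<rho> + 2 / (\<mu> - 1)))"
    by (rule nn_integral_multc) simp
  also have "\<dots> \<le> 1 * ennreal (1 + (2 / \<rho> + 2 / (\<mu> - 1)))"
    using F by (intro mult_right_mono) auto
  finally show ?thesis by simp
qed

text \<open>At each point the larger of \<open>F x\<close> and \<open>G y\<close> takes the role of
  \<open>s\<close> in \<open>hls_pointwise\<close>. Adding the majorants for both orderings avoids
  cutting the plane into regions.\<close>

lemma hardy_littlewood_sobolev_normalized:
  fixes F G :: "real \<Rightarrow> real"
  assumes [measurable]: "F \<in> borel_measurable borel" "G \<in> borel_measurable borel"
    and F: "\<And>x. 0 \<le> F x" "(\<integral>\<^sup>+x. F x \<partial>lborel) \<le> 1"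
    and G: "\<And>x. 0 \<le> G x" "(\<integral>\<^sup>+x. G x \<partial>lborel) \<le> 1"
    and pq: "1 < p" "1 < q" "0 < \<rho>" "1 / p + 1 / q = 1 + \<rho>"
  shows "(\<integral>\<^sup>+x. \<integral>\<^sup>+y. F x powr (1 / p) * G y powr (1 / q) * \<bar>x - y\<bar> powr (\<rho> - 1) \<partial>lborel \<partial>lborel)
    \<le> ennreal (hls_const p q \<rho>)"
proof -
  let ?m = "\<lambda>q. (1 - \<rho>) * (q / (q - 1))"
  have qp: "1 / q + 1 / p = 1 + \<rho>" using pq by simp
  have m: "1 < ?m q" "1 < ?m p"
    using conj_exponent_scaled_gt_1 pq qp by blast+
  have "(\<integral>\<^sup>+x. \<integral>\<^sup>+y. F x powr (1 / p) * G y powr (1 / q) * \<bar>x - y\<bar> powr (\<rho> - 1) \<partial>lborel \<partial>lborel)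
     \<le> (\<integral>\<^sup>+x. \<integral>\<^sup>+y. ennreal (F x * (G y + hls_kernel \<rho> (?m q) (F x) (x - y)))
            + ennreal (G y * (F x + hls_kernel \<rho> (?m p) (G y) (y - x))) \<partial>lborel \<partial>lborel)"
  proof (intro nn_integral_mono)
    fix x y
    have "F x powr (1 / p) * G y powr (1 / q) * \<bar>x - y\<bar> powr (\<rho> - 1)
      \<le> F x * (G y + hls_kernel \<rho> (?m q) (F x) (x - y))
            + G y * (F x + hls_kernel \<rho> (?m p) (G y) (y - x))"
    proof (cases "G y \<le> F x")
      case True
      with hls_pointwise[of p q \<rho> "G y" "F x" "x - y"] pq F G hls_kernel_nonneg show ?thesis
        by (auto intro!: add_increasing2)
    next
      case False
      with hls_pointwise[of q p \<rho> "F x" "G y" "y - x"] pq F G hls_kernel_nonneg show ?thesis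
        by (auto intro!: add_increasing simp: abs_minus_commute mult_ac add_ac)
    qed
    then show "ennreal (F x powr (1 / p) * G y powr (1 / q) * \<bar>x - y\<bar> powr (\<rho> - 1))
      \<le> ennreal (F x * (G y + hls_kernel \<rho> (?m q) (F x) (x - y)))
            + ennreal (G y * (F x + hls_kernel \<rho> (?m p) (G y) (y - x)))"
      by (metis (no_types, lifting) F(1) G(1) hls_kernel_nonneg add_nonneg_nonneg mult_nonneg_nonneg
          ennreal_plus ennreal_leI)
  qed
  also have "\<dots> = (\<integral>\<^sup>+x. \<integral>\<^sup>+y. F x * (G y + hls_kernel \<rho> (?m q) (F x) (x - y)) \<partial>lborel \<partial>lborel)
      + (\<integral>\<^sup>+x. \<integral>\<^sup>+y. G y * (F x + hls_kernel \<rho> (?m p) (G y) (y - x)) \<partial>lborel \<partial>lborel)"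
    by (subst nn_integral_add[symmetric]) (auto intro!: nn_integral_cong nn_integral_add)
  \<comment> \<open>Exchanging the order of integration gives the second term the form of
    \<open>hardy_littlewood_sobolev_half\<close> with \<open>F\<close> and \<open>G\<close>, hence
    \<open>p\<close> and \<open>q\<close>, interchanged.\<close>
  also have "(\<integral>\<^sup>+x. \<integral>\<^sup>+y. G y * (F x + hls_kernel \<rho> (?m p) (G y) (y - x)) \<partial>lborel \<partial>lborel)
      = (\<integral>\<^sup>+y. \<integral>\<^sup>+x. G y * (F x + hls_kernel \<rho> (?m p) (G y) (y - x)) \<partial>lborel \<partial>lborel)"
    by (rule lborel_pair.Fubini') simp
  also have "(\<integral>\<^sup>+x. \<integral>\<^sup>+y. F x * (G y + hls_kernel \<rho> (?m q) (F x) (x - y)) \<partial>lborel \<partial>lborel)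
      + (\<integral>\<^sup>+y. \<integral>\<^sup>+x. G y * (F x + hls_kernel \<rho> (?m p) (G y) (y - x)) \<partial>lborel \<partial>lborel)
      \<le> ennreal (1 + (2 / \<rho> + 2 / (?m q - 1))) + ennreal (1 + (2 / \<rho> + 2 / (?m p - 1)))"
    using m pq F G by (intro add_mono hardy_littlewood_sobolev_half) auto
  also have "\<dots> = ennreal (hls_const p q \<rho>)"
    using m pq by (subst ennreal_plus[symmetric]) (auto simp: hls_const_def intro!: arg_cong[where f = ennreal])
  finally show ?thesis .
qed

text \<open>By homogeneity it suffices to treat \<open>f x powr p / A\<close> and
  \<open>g x powr q / B\<close>, which are densities of mass \<open>1\<close>.\<close>

lemma hardy_littlewood_sobolev:
  fixes f g :: "real \<Rightarrow> real"
  assumes [measurable]: "f \<in> borel_measurable borel" "g \<in> borel_measurable borel"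
    and f: "\<And>x. 0 \<le> f x" "(\<integral>\<^sup>+x. f x powr p \<partial>lborel) = ennreal A" "0 \<le> A"
    and g: "\<And>x. 0 \<le> g x" "(\<integral>\<^sup>+x. g x powr q \<partial>lborel) = ennreal B" "0 \<le> B"
    and pq: "1 < p" "1 < q" "0 < \<rho>" "1 / p + 1 / q = 1 + \<rho>"
  shows "(\<integral>\<^sup>+x. \<integral>\<^sup>+y. f x * g y * \<bar>x - y\<bar> powr (\<rho> - 1) \<partial>lborel \<partial>lborel)
    \<le> ennreal (hls_const p q \<rho> * A powr (1 / p) * B powr (1 / q))"
proof (cases "A = 0 \<or> B = 0")
  case True
  \<comment> \<open>Normalisation would divide by \<open>0\<close>; instead, one factor vanishes
    almost everywhere and the double integral is \<open>0\<close>.\<close>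
  then have "(AE x in lborel. f x = 0) \<or> (AE x in lborel. g x = 0)"
    using f g by (auto simp: nn_integral_0_iff_AE)
  then have "(\<integral>\<^sup>+x. \<integral>\<^sup>+y. f x * g y * \<bar>x - y\<bar> powr (\<rho> - 1) \<partial>lborel \<partial>lborel) = 0"
  proof
    assume "AE x in lborel. f x = 0"
    then show ?thesis by (subst nn_integral_0_iff_AE) (auto elim!: eventually_mono)
  next
    assume "AE x in lborel. g x = 0"
    then have "(\<integral>\<^sup>+y. f x * g y * \<bar>x - y\<bar> powr (\<rho> - 1) \<partial>lborel) = 0" for x
      by (subst nn_integral_0_iff_AE) (auto elim!: eventually_mono)
    then show ?thesis by simp
  qed
  then show ?thesis by simp
next
  case False
  then have AB: "0 < A" "0 < B" using f g by auto
  let ?F = "\<lambda>x. f x powr p / A" and ?G = "\<lambda>x. g x powr q / B"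
  have "(\<integral>\<^sup>+x. ?F x \<partial>lborel) = (\<integral>\<^sup>+x. f x powr p \<partial>lborel) / ennreal A"
    using AB by (subst nn_integral_divide[symmetric]) (auto simp: divide_ennreal)
  also have "\<dots> = 1" using AB f by (simp add: divide_ennreal)
  finally have F: "(\<integral>\<^sup>+x. ?F x \<partial>lborel) \<le> 1" by simp
  have "(\<integral>\<^sup>+x. ?G x \<partial>lborel) = (\<integral>\<^sup>+x. g x powr q \<partial>lborel) / ennreal B"
    using AB by (subst nn_integral_divide[symmetric]) (auto simp: divide_ennreal)
  also have "\<dots> = 1" using AB g by (simp add: divide_ennreal)
  finally have G: "(\<integral>\<^sup>+x. ?G x \<partial>lborel) \<le> 1" by simp
  let ?D = "A powr (1 / p) * B powr (1 / q)"
  have eq: "f x * g y * \<bar>x - y\<bar> powr (\<rho> - 1)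
      = ?D * (?F x powr (1 / p) * ?G y powr (1 / q) * \<bar>x - y\<bar> powr (\<rho> - 1))" for x y
    using AB f g pq by (simp add: powr_divide powr_powr field_simps)
  have "(\<integral>\<^sup>+x. \<integral>\<^sup>+y. f x * g y * \<bar>x - y\<bar> powr (\<rho> - 1) \<partial>lborel \<partial>lborel)
      = (\<integral>\<^sup>+x. \<integral>\<^sup>+y. ennreal ?D * ennreal (?F x powr (1 / p) * ?G y powr (1 / q) * \<bar>x - y\<bar> powr (\<rho> - 1)) \<partial>lborel \<partial>lborel)"
    unfolding eq by (intro nn_integral_cong ennreal_mult) auto
  also have "\<dots> = ennreal ?D * (\<integral>\<^sup>+x. \<integral>\<^sup>+y. ?F x powr (1 / p) * ?G y powr (1 / q) * \<bar>x - y\<bar> powr (\<rho> - 1) \<partial>lborel \<partial>lborel)"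
    by (simp add: nn_integral_cmult del: ennreal_mult')
  also have "\<dots> \<le> ennreal ?D * ennreal (hls_const p q \<rho>)"
    using F G AB pq by (intro mult_left_mono hardy_littlewood_sobolev_normalized) auto
  also have "\<dots> = ennreal (hls_const p q \<rho> * A powr (1 / p) * B powr (1 / q))"
    by (subst ennreal_mult'[symmetric]) (auto simp: mult_ac)
  finally show ?thesis .
qed

section \<open>The change of variables in the plane of scales and shifts\<close>

text \<open>The substitution \<open>a = c / t\<close> is proved as an identity of measures, so that
  it serves every nonnegative Borel function. By \<open>lborel_eqI\<close> only open intervals have
  to be checked, where the classical change of variables on the line applies.\<close>

lemma nn_integral_inversion:
  fixes f :: "real \<Rightarrow> ennreal" and c :: real
  assumes [measurable]: "f \<in> borel_measurable borel" and c: "c \<noteq> 0"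
  shows "(\<integral>\<^sup>+a. f a \<partial>lborel) = (\<integral>\<^sup>+t. f (c / t) * ennreal (\<bar>c\<bar> / t\<^sup>2) \<partial>lborel)"
proof -
  let ?M = "distr (density lborel (\<lambda>t. ennreal (\<bar>c\<bar> / t\<^sup>2))) borel (\<lambda>t. c / t)"
  have "lborel = ?M"
  proof (rule lborel_eqI)
    fix l u :: real
    assume "\<And>b. b \<in> Basis \<Longrightarrow> l \<bullet> b \<le> u \<bullet> b"
    then have lu: "l \<le> u" by simp
    \<comment> \<open>The point \<open>t = 0\<close> is removed because \<open>c / 0 = 0\<close>
      would put it into the preimage of every open interval around \<open>0\<close>. The image of
      \<open>S\<close> then misses at most the point \<open>0\<close> of the interval.\<close>
    define S where "S = {t. t \<noteq> 0 \<and> c / t \<in> {l<..<u}}"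
    have S [measurable]: "S \<in> sets borel" unfolding S_def by measurable
    have im: "(\<lambda>t. c / t) ` S = {l<..<u} - {0}"
    proof (intro equalityI subsetI)
      fix a assume "a \<in> {l<..<u} - {0}"
      then have "c / a \<in> S" "a = c / (c / a)" using c by (auto simp: S_def)
      then show "a \<in> (\<lambda>t. c / t) ` S" by blast
    qed (use c in \<open>auto simp: S_def\<close>)
    have 1: "((\<lambda>_. 1::real) has_integral (u - l)) ({l<..<u} - {0})"
    proof -
      have "((\<lambda>_. 1::real) has_integral (u - l)) {l<..<u}"
        using has_integral_const_real[of "1::real" l u] lu by (simp add: has_integral_Icc_iff_Ioo)
      then show ?thesis
        by (subst has_integral_spike_set_eq[of _ "{l<..<u}"]) (auto intro: negligible_subset[of "{0}"])
    qed
    have "(\<lambda>_. 1::real) absolutely_integrable_on ((\<lambda>t. c / t) ` S)"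
      unfolding im using 1 by (intro nonnegative_absolutely_integrable_1) auto
    moreover have "integral ((\<lambda>t. c / t) ` S) (\<lambda>_. 1::real) = u - l"
      unfolding im using 1 by (rule integral_unique)
    moreover have "((\<lambda>t. c / t) has_field_derivative - c / t\<^sup>2) (at t within S)" if "t \<in> S" for t
      using that by (auto simp: S_def power2_eq_square intro!: derivative_eq_intros)
    moreover have "inj_on (\<lambda>t. c / t) S"
      using c by (auto simp: S_def inj_on_def)
    ultimately have "(\<lambda>t. \<bar>- c / t\<^sup>2\<bar> * 1) absolutely_integrable_on S
        \<and> integral S (\<lambda>t. \<bar>- c / t\<^sup>2\<bar> * 1) = u - l"
      by (subst has_absolute_integral_change_of_variables_1'[where g = "\<lambda>t. c / t" and f = "\<lambda>_. 1"]) auto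
    then have "((\<lambda>t. \<bar>c\<bar> / t\<^sup>2) has_integral (u - l)) S"
      using c by (auto simp: absolutely_integrable_on_def has_integral_integral abs_divide)
    then have "(\<integral>\<^sup>+t. ennreal (\<bar>c\<bar> / t\<^sup>2) * indicator S t \<partial>lborel) = ennreal (u - l)"
      by (intro nn_integral_has_integral_lebesgue') auto
    \<comment> \<open>At \<open>t = 0\<close> the density is \<open>\<bar>c\<bar> / 0 = 0\<close>,
      so the full preimage of the interval may be replaced by \<open>S\<close>.\<close>
    moreover have "emeasure ?M (box l u) = (\<integral>\<^sup>+t. ennreal (\<bar>c\<bar> / t\<^sup>2) * indicator S t \<partial>lborel)"
      using emeasure_density[of "\<lambda>t. ennreal (\<bar>c\<bar> / t\<^sup>2)" lborel "(\<lambda>t. c / t) -` {l<..<u}"]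
        measurable_sets[of "\<lambda>t. c / t" borel borel "{l<..<u}"]
      by (subst emeasure_distr) (auto simp: S_def box_real indicator_def intro!: nn_integral_cong)
    ultimately show "emeasure ?M (box l u) = (\<Prod>b\<in>Basis. (u - l) \<bullet> b)"
      by simp
  qed simp
  then have "(\<integral>\<^sup>+a. f a \<partial>lborel) = (\<integral>\<^sup>+a. f a \<partial>?M)" by simp
  also have "\<dots> = (\<integral>\<^sup>+t. f (c / t) * ennreal (\<bar>c\<bar> / t\<^sup>2) \<partial>lborel)"
    by (subst nn_integral_distr) (auto simp: nn_integral_density mult.commute)
  finally show ?thesis .
qed

text \<open>Two substitutions on the line replace one in the plane. For fixed \<open>a\<close>,
  setting \<open>b = w - a * x\<close> turns the second argument into
  \<open>x + (v - w) / a\<close>; after Tonelli's theorem, \<open>a = (v - w) / t\<close> and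
  \<open>y = x + t\<close> are used for fixed \<open>x\<close>.\<close>

lemma nn_integral_wavelet_substitution:
  fixes f g :: "real \<Rightarrow> ennreal" and v w \<rho> :: real
  assumes [measurable]: "f \<in> borel_measurable borel" "g \<in> borel_measurable borel" and vw: "v \<noteq> w"
  shows "(\<integral>\<^sup>+a. \<integral>\<^sup>+b. f ((w - b) / a) * g ((v - b) / a) * ennreal (\<bar>a\<bar> powr (- \<rho> - 2)) \<partial>lborel \<partial>lborel)
    = ennreal (\<bar>v - w\<bar> powr (- \<rho>)) * (\<integral>\<^sup>+x. \<integral>\<^sup>+y. f x * g y * ennreal (\<bar>x - y\<bar> powr (\<rho> - 1)) \<partial>lborel \<partial>lborel)"
proof -
  have "(\<integral>\<^sup>+b. f ((w - b) / a) * g ((v - b) / a) * ennreal (\<bar>a\<bar> powr (- \<rho> - 2)) \<partial>lborel)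
      = (\<integral>\<^sup>+x. f x * g (x + (v - w) / a) * ennreal (\<bar>a\<bar> powr (- \<rho> - 1)) \<partial>lborel)" if "a \<noteq> 0" for a
  proof -
    \<comment> \<open>The Jacobian \<open>\<bar>a\<bar>\<close> of \<open>b = w - a * x\<close>
      raises the exponent by one.\<close>
    have "\<bar>a\<bar> powr (- \<rho> - 1) = \<bar>a\<bar> * \<bar>a\<bar> powr (- \<rho> - 2)"
      using that powr_add[of "\<bar>a\<bar>" 1 "- \<rho> - 2"] by (simp add: minus_diff_commute)
    moreover have "(w - (w + - a * x)) / a = x" "(v - (w + - a * x)) / a = x + (v - w) / a" for x
      using that by (simp_all add: field_simps)
    ultimately show ?thesis
      using that
      by (subst nn_integral_real_affine[where c = "- a" and t = w])
         (auto simp: ennreal_mult mult_ac simp flip: nn_integral_cmult)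
  qed
  then have "(\<integral>\<^sup>+a. \<integral>\<^sup>+b. f ((w - b) / a) * g ((v - b) / a) * ennreal (\<bar>a\<bar> powr (- \<rho> - 2)) \<partial>lborel \<partial>lborel)
    = (\<integral>\<^sup>+a. \<integral>\<^sup>+x. f x * g (x + (v - w) / a) * ennreal (\<bar>a\<bar> powr (- \<rho> - 1)) \<partial>lborel \<partial>lborel)"
    using AE_lborel_singleton[of "0::real"] by (intro nn_integral_cong_AE) (auto elim!: eventually_mono)
  also have "\<dots> = (\<integral>\<^sup>+x. \<integral>\<^sup>+a. f x * g (x + (v - w) / a) * ennreal (\<bar>a\<bar> powr (- \<rho> - 1)) \<partial>lborel \<partial>lborel)"
    by (rule lborel_pair.Fubini') simp
  also have "\<dots> = (\<integral>\<^sup>+x. ennreal (\<bar>v - w\<bar> powr (- \<rho>)) * (\<integral>\<^sup>+y. f x * g y * ennreal (\<bar>x - y\<bar> powr (\<rho> - 1)) \<partial>lborel) \<partial>lborel)"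
  proof (intro nn_integral_cong)
    fix x
    let ?c = "v - w"
    have "(\<integral>\<^sup>+a. f x * g (x + ?c / a) * ennreal (\<bar>a\<bar> powr (- \<rho> - 1)) \<partial>lborel)
      = (\<integral>\<^sup>+t. f x * g (x + ?c / (?c / t)) * ennreal (\<bar>?c / t\<bar> powr (- \<rho> - 1)) * ennreal (\<bar>?c\<bar> / t\<^sup>2) \<partial>lborel)"
      using vw by (intro nn_integral_inversion) auto
    \<comment> \<open>The modulus of \<open>t\<close> is written as
      \<open>\<bar>x - (x + t)\<bar>\<close>, so that \<open>t\<close> occurs only through
      \<open>x + t\<close> and the translation \<open>y = x + t\<close> applies.\<close>
    also have "\<dots> = (\<integral>\<^sup>+t. ennreal (\<bar>?c\<bar> powr (- \<rho>)) * (f x * g (x + t) * ennreal (\<bar>x - (x + t)\<bar> powr (\<rho> - 1))) \<partial>lborel)"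
    proof (intro nn_integral_cong_AE, use AE_lborel_singleton[of "0::real"] in eventually_elim)
      case (elim t)
      \<comment> \<open>With the Jacobian included, \<open>\<bar>?c\<bar>\<close> has exponent
        \<open>(- \<rho> - 1) + 1\<close> and \<open>\<bar>t\<bar>\<close> has exponent
        \<open>(\<rho> + 1) - 2\<close>.\<close>
      have "\<bar>?c / t\<bar> powr (- \<rho> - 1) * (\<bar>?c\<bar> / t\<^sup>2) = \<bar>?c\<bar> powr (- \<rho>) * \<bar>t\<bar> powr (\<rho> - 1)"
        using elim vw
        by (simp add: abs_divide powr_divide powr_diff powr_minus field_simps power2_eq_square)
      then have "ennreal (\<bar>?c / t\<bar> powr (- \<rho> - 1)) * ennreal (\<bar>?c\<bar> / t\<^sup>2)
          = ennreal (\<bar>?c\<bar> powr (- \<rho>)) * ennreal (\<bar>t\<bar> powr (\<rho> - 1))"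
        by (simp flip: ennreal_mult)
      then show ?case using elim vw by (simp add: mult_ac)
    qed
    also have "\<dots> = ennreal (\<bar>?c\<bar> powr (- \<rho>)) * (\<integral>\<^sup>+t. f x * g (x + t) * ennreal (\<bar>x - (x + t)\<bar> powr (\<rho> - 1)) \<partial>lborel)"
      by (rule nn_integral_cmult) simp
    also have "(\<integral>\<^sup>+t. f x * g (x + t) * ennreal (\<bar>x - (x + t)\<bar> powr (\<rho> - 1)) \<partial>lborel)
       = (\<integral>\<^sup>+y. f x * g y * ennreal (\<bar>x - y\<bar> powr (\<rho> - 1)) \<partial>lborel)"
      by (subst (2) nn_integral_real_affine[where c = 1 and t = x]) auto
    finally show "(\<integral>\<^sup>+a. f x * g (x + ?c / a) * ennreal (\<bar>a\<bar> powr (- \<rho> - 1)) \<partial>lborel)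
      = ennreal (\<bar>?c\<bar> powr (- \<rho>)) * (\<integral>\<^sup>+y. f x * g y * ennreal (\<bar>x - y\<bar> powr (\<rho> - 1)) \<partial>lborel)" .
  qed
  also have "\<dots> = ennreal (\<bar>v - w\<bar> powr (- \<rho>)) * (\<integral>\<^sup>+x. \<integral>\<^sup>+y. f x * g y * ennreal (\<bar>x - y\<bar> powr (\<rho> - 1)) \<partial>lborel \<partial>lborel)"
    by (rule nn_integral_cmult) simp
  finally show ?thesis .
qed

section \<open>Borel representatives and the completed measure\<close>

text \<open>Borel measurability is preserved by composition with the Borel map
  \<open>(a, b) \<mapsto> (t - b) / a\<close>, as needed for Tonelli's theorem with
  \<open>lborel\<close>. Real and imaginary parts are replaced separately.\<close>

lemma borel_representative:
  fixes f :: "real \<Rightarrow> complex"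
  assumes "f \<in> borel_measurable lebesgue"
  obtains g where "g \<in> borel_measurable borel" "AE x in lborel. f x = g x"
proof -
  have "(\<lambda>x. Re (f x)) \<in> borel_measurable lebesgue" "(\<lambda>x. Im (f x)) \<in> borel_measurable lebesgue"
    using assms by (auto simp: borel_measurable_complex_iff)
  then obtain r i where "r \<in> borel_measurable lborel" "AE x in lborel. Re (f x) = r x"
      "i \<in> borel_measurable lborel" "AE x in lborel. Im (f x) = i x"
    using completion_ex_borel_measurable_real by metis
  then show thesis
    by (intro that[of "\<lambda>x. Complex (r x) (i x)"])
       (auto simp: borel_measurable_complex_iff complex_eq_iff)
qed

text \<open>Preimages under \<open>f\<close> and \<open>g\<close> differ by subsets of a null set,
  and all of these are measurable in the completion.\<close>

lemma measurable_completion_cong_AE: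
  assumes g: "g \<in> measurable M N" and sp: "\<And>x. x \<in> space M \<Longrightarrow> f x \<in> space N"
    and eq: "AE x in M. f x = g x"
  shows "f \<in> measurable (completion M) N"
proof (rule measurableI)
  fix A assume A: "A \<in> sets N"
  have "{x \<in> space (completion M). f x \<in> A \<and> f x \<noteq> g x} \<in> sets (completion M)"
       "{x \<in> space (completion M). g x \<in> A \<and> f x \<noteq> g x} \<in> sets (completion M)"
    by (rule sets_completion_AE[unfolded pred_def], use eq in eventually_elim, blast)+
  moreover have "g -` A \<inter> space M \<in> sets (completion M)"
    using g A by (auto intro: measurable_sets)
  moreover have "f -` A \<inter> space (completion M)
      = (g -` A \<inter> space M - {x \<in> space (completion M). g x \<in> A \<and> f x \<noteq> g x})
        \<union> {x \<in> space (completion M). f x \<in> A \<and> f x \<noteq> g x}"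
    by auto
  ultimately show "f -` A \<inter> space (completion M) \<in> sets (completion M)"
    by simp
qed (use sp in simp)

text \<open>These evaluate Lebesgue integrals of the given functions on Borel representatives.
  Measurability of \<open>f\<close> is derived from its almost everywhere equality with
  \<open>g\<close>.\<close>

lemma
  fixes f g :: "'a \<Rightarrow> 'b::{banach, second_countable_topology}"
  assumes g: "g \<in> borel_measurable M" and eq: "AE x in M. f x = g x"
  shows integrable_completion_cong_AE: "integrable (completion M) f \<longleftrightarrow> integrable M g"
    and integral_completion_cong_AE: "integral\<^sup>L (completion M) f = integral\<^sup>L M g"
proof -
  have f: "f \<in> borel_measurable (completion M)"
    using measurable_completion_cong_AE[OF g _ eq] by simp
  have g': "g \<in> borel_measurable (completion M)"
    using g by (rule measurable_completion)
  show "integrable (completion M) f \<longleftrightarrow> integrable M g"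
    using integrable_cong_AE[OF f g' AE_completion[OF eq]] integrable_completion[OF g] by simp
  show "integral\<^sup>L (completion M) f = integral\<^sup>L M g"
    using integral_cong_AE[OF f g' AE_completion[OF eq]] integral_completion[OF g] by simp
qed

text \<open>This carries almost everywhere equality over to dilated arguments. For fixed
  \<open>a \<noteq> 0\<close> the map \<open>b \<mapsto> (t - b) / a\<close> is affine and preserves
  null sets; Fubini's theorem for null sets then yields the planar claim and the one with
  \<open>b\<close> outermost.\<close>

lemma AE_dilate:
  fixes P :: "real \<Rightarrow> bool"
  assumes "AE x in lborel. P x"
  shows AE_dilate_pair: "AE z in lborel. P ((t - snd z) / fst z)"
    and AE_dilate_iterated: "AE b in lborel. AE a in lborel. P ((t - b) / a)"
proof -
  \<comment> \<open>The exceptional set is enlarged to a Borel null set, whose preimage in the plane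
    is measurable.\<close>
  from assms obtain N where N: "{x. \<not> P x} \<subseteq> N" "N \<in> null_sets lborel"
    by (auto elim: AE_E simp: null_sets_def)
  then have [measurable]: "N \<in> sets borel" by auto
  have "AE b in lborel. (t - b) / a \<notin> N" if "a \<noteq> 0" for a
    using AE_borel_affine[of "- 1 / a" "\<lambda>x. x \<notin> N" "t / a"] that AE_not_in[OF N(2)]
    by (simp add: diff_divide_distrib)
  then have ab: "AE a in lborel. AE b in lborel. (t - b) / a \<notin> N"
    using AE_lborel_singleton[of "0::real"] by (auto elim: eventually_mono)
  moreover have "{z \<in> space (lborel \<Otimes>\<^sub>M lborel). (t - snd z) / fst z \<notin> N} \<in> sets (lborel \<Otimes>\<^sub>M lborel)"
    by measurable
  ultimately have "AE z in lborel \<Otimes>\<^sub>M lborel. (t - snd z) / fst z \<notin> N"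
    by (intro lborel_pair.AE_pair_measure) auto
  then show "AE z in lborel. P ((t - snd z) / fst z)"
    unfolding lborel_prod by eventually_elim (use N in blast)
  have "AE b in lborel. AE a in lborel. (t - b) / a \<notin> N"
    using ab by (subst (asm) lborel_pair.AE_commute) measurable
  then show "AE b in lborel. AE a in lborel. P ((t - b) / a)"
    using N by (auto elim!: eventually_mono)
qed

section \<open>The modulus of the integrand\<close>

lemma borel_measurable_basic_integrand [measurable]:
  assumes [measurable]: "\<phi> \<in> borel_measurable borel" "\<psi> \<in> borel_measurable borel" "\<eta> \<in> borel_measurable borel"
    "u \<in> borel_measurable M" "a \<in> borel_measurable M" "b \<in> borel_measurable M"
  shows "(\<lambda>x. basic_integrand \<alpha> \<rho> \<phi> \<psi> \<eta> (u x) v w (a x) (b x)) \<in> borel_measurable M"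
proof -
  have *: "(\<lambda>x. frac_dilate \<alpha> \<rho> f (a x) (b x) (t x)) \<in> borel_measurable M"
    if [measurable]: "f \<in> borel_measurable borel" "t \<in> borel_measurable M" for f t
    unfolding frac_dilate_def by measurable
  note *[measurable]
  have [measurable]: "cnj \<in> borel_measurable borel"
    by (intro borel_measurable_continuous_onI continuous_intros)
  show ?thesis unfolding basic_integrand_def by measurable
qed

lemma basic_integrand_cong:
  assumes "\<phi> ((u - b) / a) = \<phi>' ((u - b) / a)" "\<psi> ((w - b) / a) = \<psi>' ((w - b) / a)"
    "\<eta> ((v - b) / a) = \<eta>' ((v - b) / a)"
  shows "basic_integrand \<alpha> \<rho> \<phi> \<psi> \<eta> u v w a b = basic_integrand \<alpha> \<rho> \<phi>' \<psi>' \<eta>' u v w a b"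
  using assms by (simp add: basic_integrand_def frac_dilate_def)

text \<open>The exponent of the chirp factor is purely imaginary, so the factor has modulus
  \<open>1\<close>, and \<open>\<alpha>\<close> disappears from the estimates.\<close>

lemma norm_frac_dilate: "cmod (frac_dilate \<alpha> \<rho> f a b t) = \<bar>a\<bar> powr (- \<rho>) * cmod (f ((t - b) / a))"
proof -
  have "- (\<i> / 2) * complex_of_real r = \<i> * complex_of_real (- r / 2)" for r by simp
  then show ?thesis
    unfolding frac_dilate_def by (simp only: norm_mult norm_exp_i_times) simp
qed

lemma norm_basic_integrand:
  "cmod (basic_integrand \<alpha> \<rho> \<phi> \<psi> \<eta> u v w a b)
    = cmod (\<psi> ((w - b) / a)) * cmod (\<eta> ((v - b) / a)) * \<bar>a\<bar> powr (- \<rho> - 3) * cmod (\<phi> ((u - b) / a))"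
proof -
  \<comment> \<open>This includes \<open>a = 0\<close>, where both sides are
    \<open>0\<close>.\<close>
  have "\<bar>a\<bar> powr (- \<rho>) * \<bar>a\<bar> powr (- \<rho>) * \<bar>a\<bar> powr (- \<rho>) * \<bar>a\<bar> powr (2 * \<rho> - 3) = \<bar>a\<bar> powr (- \<rho> - 3)"
    by (simp flip: powr_add)
  then show ?thesis
    by (simp add: basic_integrand_def norm_mult norm_frac_dilate mult_ac)
qed

text \<open>Tonelli's theorem allows \<open>u\<close> to be integrated first, which yields
  \<open>\<bar>a\<bar>\<close> times the norm of \<open>\<phi>\<close>. The exponent of
  \<open>\<bar>a\<bar>\<close> becomes \<open>- \<rho> - 2\<close>, the one treated in
  \<open>nn_integral_wavelet_substitution\<close>.\<close>

lemma nn_integral_norm_basic_integrand: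
  assumes [measurable]: "\<phi> \<in> borel_measurable borel" "\<psi> \<in> borel_measurable borel" "\<eta> \<in> borel_measurable borel"
    and "v \<noteq> w"
  shows "(\<integral>\<^sup>+u. \<integral>\<^sup>+z. cmod (basic_integrand \<alpha> \<rho> \<phi> \<psi> \<eta> u v w (fst z) (snd z)) \<partial>lborel \<partial>lborel)
    = ennreal (\<bar>v - w\<bar> powr (- \<rho>))
      * (\<integral>\<^sup>+x. \<integral>\<^sup>+y. cmod (\<psi> x) * cmod (\<eta> y) * \<bar>x - y\<bar> powr (\<rho> - 1) \<partial>lborel \<partial>lborel)
      * (\<integral>\<^sup>+x. cmod (\<phi> x) \<partial>lborel)"
proof -
  let ?I = "\<integral>\<^sup>+x. cmod (\<phi> x) \<partial>lborel"
  let ?h = "\<lambda>u a b. ennreal (cmod (basic_integrand \<alpha> \<rho> \<phi> \<psi> \<eta> u v w a b))"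
  let ?k = "\<lambda>a b. ennreal (cmod (\<psi> ((w - b) / a))) * ennreal (cmod (\<eta> ((v - b) / a))) * ennreal (\<bar>a\<bar> powr (- \<rho> - 2))"
  have u: "(\<integral>\<^sup>+u. ?h u a b \<partial>lborel) = ?k a b * ?I" if "a \<noteq> 0" for a b
  proof -
    have "?I = ennreal (1 / \<bar>a\<bar>) * (\<integral>\<^sup>+u. cmod (\<phi> ((u - b) / a)) \<partial>lborel)"
      using that by (subst nn_integral_real_affine[where c = "1 / a" and t = "- b / a"]) (auto simp: diff_divide_distrib)
    then have "ennreal \<bar>a\<bar> * ?I = (\<integral>\<^sup>+u. cmod (\<phi> ((u - b) / a)) \<partial>lborel)"
      using that by (simp flip: mult.assoc ennreal_mult)
    moreover have "\<bar>a\<bar> powr (- \<rho> - 2) = \<bar>a\<bar> powr (- \<rho> - 3) * \<bar>a\<bar>"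
      using that powr_add[of "\<bar>a\<bar>" "- \<rho> - 3" 1] by (simp add: minus_diff_commute)
    ultimately show ?thesis
      by (simp add: norm_basic_integrand ennreal_mult nn_integral_cmult mult.assoc)
  qed
  have "(\<integral>\<^sup>+u. \<integral>\<^sup>+z. ?h u (fst z) (snd z) \<partial>lborel \<partial>lborel) = (\<integral>\<^sup>+z. \<integral>\<^sup>+u. ?h u (fst z) (snd z) \<partial>lborel \<partial>lborel)"
    by (rule lborel_pair.Fubini') (simp add: case_prod_beta flip: lborel_prod)
  also have "\<dots> = (\<integral>\<^sup>+z. \<integral>\<^sup>+u. ?h u (fst z) (snd z) \<partial>lborel \<partial>(lborel \<Otimes>\<^sub>M lborel))"
    by (simp add: lborel_prod)
  also have "\<dots> = (\<integral>\<^sup>+a. \<integral>\<^sup>+b. \<integral>\<^sup>+u. ?h u a b \<partial>lborel \<partial>lborel \<partial>lborel)"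
    by (subst lborel.nn_integral_fst[symmetric]) auto
  also have "\<dots> = (\<integral>\<^sup>+a. (\<integral>\<^sup>+b. ?k a b \<partial>lborel) * ?I \<partial>lborel)"
    using AE_lborel_singleton[of "0::real"]
    by (intro nn_integral_cong_AE) (auto elim!: eventually_mono simp: u nn_integral_multc)
  also have "\<dots> = (\<integral>\<^sup>+a. \<integral>\<^sup>+b. ?k a b \<partial>lborel \<partial>lborel) * ?I"
    by (rule nn_integral_multc) simp
  also have "(\<integral>\<^sup>+a. \<integral>\<^sup>+b. ?k a b \<partial>lborel \<partial>lborel) = ennreal (\<bar>v - w\<bar> powr (- \<rho>))
      * (\<integral>\<^sup>+x. \<integral>\<^sup>+y. ennreal (cmod (\<psi> x)) * ennreal (cmod (\<eta> y)) * ennreal (\<bar>x - y\<bar> powr (\<rho> - 1)) \<partial>lborel \<partial>lborel)"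
    using assms by (intro nn_integral_wavelet_substitution) auto
  finally show ?thesis
    by (simp add: ennreal_mult)
qed

section \<open>From a kernel bound to the basic function\<close>

text \<open>The finite iterated integral of the modulus makes \<open>h\<close> integrable on the
  product space. Fubini's theorem then gives the two integrability claims, and the triangle
  inequality the norm bound.\<close>

lemma fubini_norm_bound:
  fixes h :: "'a::euclidean_space \<Rightarrow> 'b::euclidean_space \<Rightarrow> complex"
  assumes [measurable]: "case_prod h \<in> borel_measurable (lborel \<Otimes>\<^sub>M lborel)"
    and bound: "(\<integral>\<^sup>+u. \<integral>\<^sup>+z. cmod (h u z) \<partial>lborel \<partial>lborel) \<le> ennreal T" and "0 \<le> T"
  shows "AE u in lborel. integrable lborel (h u)" "integrable lborel (\<lambda>u. \<integral>z. h u z \<partial>lborel)"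
    and "(\<integral>u. cmod (\<integral>z. h u z \<partial>lborel) \<partial>lborel) \<le> T"
proof -
  have "(\<integral>\<^sup>+x. cmod (case_prod h x) \<partial>(lborel \<Otimes>\<^sub>M lborel)) = (\<integral>\<^sup>+u. \<integral>\<^sup>+z. cmod (h u z) \<partial>lborel \<partial>lborel)"
    by (subst lborel.nn_integral_fst[symmetric]) auto
  also have "\<dots> < \<infinity>" using bound by (simp add: le_less_trans)
  finally have int: "integrable (lborel \<Otimes>\<^sub>M lborel) (case_prod h)"
    by (intro integrableI_bounded) auto
  show AE: "AE u in lborel. integrable lborel (h u)"
    using lborel_pair.AE_integrable_fst[OF int] .
  show int1: "integrable lborel (\<lambda>u. \<integral>z. h u z \<partial>lborel)"
    using lborel_pair.integrable_fst[OF int] .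
  have "ennreal (\<integral>u. cmod (\<integral>z. h u z \<partial>lborel) \<partial>lborel) = (\<integral>\<^sup>+u. cmod (\<integral>z. h u z \<partial>lborel) \<partial>lborel)"
    using int1 by (subst nn_integral_eq_integral) auto
  also have "\<dots> \<le> (\<integral>\<^sup>+u. \<integral>\<^sup>+z. cmod (h u z) \<partial>lborel \<partial>lborel)"
    using AE by (intro nn_integral_mono_AE) (auto elim!: eventually_mono intro: integral_norm_bound_ennreal)
  finally show "(\<integral>u. cmod (\<integral>z. h u z \<partial>lborel) \<partial>lborel) \<le> T"
    using bound \<open>0 \<le> T\<close> by (meson ennreal_le_iff order_trans)
qed

text \<open>This reduces both parts of the theorem to a bound \<open>K\<close> for the kernel
  integral of \<open>\<psi>\<close> and \<open>\<eta>\<close>. The estimates are made for Borel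
  representatives and transferred back.\<close>

lemma basic_fun_L1_boundI:
  assumes \<phi>: "in_Lp 1 \<phi>" and \<psi>: "\<psi> \<in> borel_measurable lebesgue" and \<eta>: "\<eta> \<in> borel_measurable lebesgue"
    and "v \<noteq> w" and adm: "0 \<le> adm_const \<phi>" and "0 \<le> K"
    and K: "(\<integral>\<^sup>+x. \<integral>\<^sup>+y. cmod (\<psi> x) * cmod (\<eta> y) * \<bar>x - y\<bar> powr (\<rho> - 1) \<partial>lborel \<partial>lborel) \<le> ennreal K"
  shows "basic_fun_L1_bound \<alpha> \<rho> \<phi> \<psi> \<eta> v w
    (inverse (adm_const \<phi>) * (\<bar>v - w\<bar> powr (- \<rho>) * K * Lp_norm 1 \<phi>))"
proof -
  obtain \<phi>' where \<phi>' [measurable]: "\<phi>' \<in> borel_measurable borel" and \<phi>_eq: "AE x in lborel. \<phi> x = \<phi>' x"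
    using \<phi> by (auto simp: in_Lp_def elim: borel_representative)
  obtain \<psi>' where \<psi>' [measurable]: "\<psi>' \<in> borel_measurable borel" and \<psi>_eq: "AE x in lborel. \<psi> x = \<psi>' x"
    using \<psi> by (rule borel_representative)
  obtain \<eta>' where \<eta>' [measurable]: "\<eta>' \<in> borel_measurable borel" and \<eta>_eq: "AE x in lborel. \<eta> x = \<eta>' x"
    using \<eta> by (rule borel_representative)
  let ?T = "\<bar>v - w\<bar> powr (- \<rho>) * K * Lp_norm 1 \<phi>"
  let ?f = "\<lambda>u a b. basic_integrand \<alpha> \<rho> \<phi> \<psi> \<eta> u v w a b"
  let ?g = "\<lambda>u a b. basic_integrand \<alpha> \<rho> \<phi>' \<psi>' \<eta>' u v w a b"
  have meas: "case_prod (\<lambda>u z. ?g u (fst z) (snd z)) \<in> borel_measurable (lborel \<Otimes>\<^sub>M lborel)"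
    by (simp add: case_prod_beta flip: lborel_prod)
  have T: "0 \<le> ?T" using \<open>0 \<le> K\<close> by (simp add: Lp_norm_def)

  have "(\<integral>\<^sup>+x. \<integral>\<^sup>+y. cmod (\<psi>' x) * cmod (\<eta>' y) * \<bar>x - y\<bar> powr (\<rho> - 1) \<partial>lborel \<partial>lborel)
      = (\<integral>\<^sup>+x. \<integral>\<^sup>+y. cmod (\<psi> x) * cmod (\<eta> y) * \<bar>x - y\<bar> powr (\<rho> - 1) \<partial>lborel \<partial>lborel)"
  proof (intro nn_integral_cong_AE, use \<psi>_eq in eventually_elim)
    case (elim x)
    then show ?case
      using \<eta>_eq by (intro nn_integral_cong_AE) (auto elim!: eventually_mono)
  qed
  moreover have "(\<integral>\<^sup>+x. cmod (\<phi>' x) \<partial>lborel) = ennreal (Lp_norm 1 \<phi>)"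
  proof -
    have "(\<integral>\<^sup>+x. cmod (\<phi>' x) \<partial>lborel) = (\<integral>\<^sup>+x. cmod (\<phi> x) \<partial>lebesgue)"
      using \<phi>_eq by (subst nn_integral_completion) (auto intro!: nn_integral_cong_AE elim!: eventually_mono)
    also have "\<dots> = ennreal (Lp_norm 1 \<phi>)"
      using \<phi> by (subst nn_integral_eq_integral) (auto simp: in_Lp_def Lp_norm_def)
    finally show ?thesis .
  qed
  ultimately have "(\<integral>\<^sup>+u. \<integral>\<^sup>+z. cmod (?g u (fst z) (snd z)) \<partial>lborel \<partial>lborel) \<le> ennreal ?T"
    using K \<open>v \<noteq> w\<close> \<open>0 \<le> K\<close>
    by (simp add: nn_integral_norm_basic_integrand ennreal_mult mult_mono Lp_norm_def)
  note fubini_norm_bound[OF meas this T]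
  then have fub: "AE u in lborel. integrable lborel (\<lambda>z. ?g u (fst z) (snd z))"
      "integrable lborel (\<lambda>u. \<integral>z. ?g u (fst z) (snd z) \<partial>lborel)"
      "(\<integral>u. cmod (\<integral>z. ?g u (fst z) (snd z) \<partial>lborel) \<partial>lborel) \<le> ?T"
    by simp_all

  \<comment> \<open>For each single \<open>u\<close>, the integrands of the two triples agree almost
    everywhere in the plane, because the dilated arguments almost everywhere avoid the three
    exceptional sets.\<close>
  have "integrable lebesgue (\<lambda>(a, b). ?f u a b) \<longleftrightarrow> integrable lborel (\<lambda>z. ?g u (fst z) (snd z))" for u
  proof (rule integrable_completion_cong_AE)
    show "AE z in lborel. (case z of (a, b) \<Rightarrow> ?f u a b) = ?g u (fst z) (snd z)"
      using AE_dilate_pair[OF \<phi>_eq, of u] AE_dilate_pair[OF \<psi>_eq, of w] AE_dilate_pair[OF \<eta>_eq, of v]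
      by eventually_elim (auto simp: case_prod_beta intro: basic_integrand_cong)
  qed (simp flip: lborel_prod)
  then have 1: "AE u in lebesgue. integrable lebesgue (\<lambda>(a, b). ?f u a b)"
    using fub(1) by (simp add: AE_completion)

  \<comment> \<open>The defining integral runs over \<open>a\<close> inside and \<open>b\<close>
    outside, so the inner integrals only have to agree for almost every \<open>b\<close>.\<close>
  have iter: "(\<integral>b. \<integral>a. ?f u a b \<partial>lebesgue \<partial>lebesgue) = (\<integral>b. \<integral>a. ?g u a b \<partial>lborel \<partial>lborel)" for u
  proof (rule integral_completion_cong_AE)
    show "AE b in lborel. (\<integral>a. ?f u a b \<partial>lebesgue) = (\<integral>a. ?g u a b \<partial>lborel)"
      using AE_dilate_iterated[OF \<phi>_eq, of u] AE_dilate_iterated[OF \<psi>_eq, of w] AE_dilate_iterated[OF \<eta>_eq, of v]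
    proof eventually_elim
      case (elim b)
      show ?case
      proof (rule integral_completion_cong_AE)
        show "AE a in lborel. ?f u a b = ?g u a b"
          using elim by eventually_elim (rule basic_integrand_cong)
      qed simp
    qed
  qed simp
  \<comment> \<open>Where the planar integral converges absolutely, Fubini's theorem identifies it
    with the iterated one; \<open>integral_snd\<close> fits because the inner variable
    \<open>a\<close> is the first component.\<close>
  have "AE u in lborel. (\<integral>b. \<integral>a. ?f u a b \<partial>lebesgue \<partial>lebesgue) = (\<integral>z. ?g u (fst z) (snd z) \<partial>lborel)"
    using fub(1)
  proof eventually_elim
    case (elim u)
    then have "integrable (lborel \<Otimes>\<^sub>M lborel) (case_prod (?g u))"
      by (simp add: lborel_prod case_prod_unfold)
    from lborel_pair.integral_snd[OF this] show ?case
      by (simp add: iter lborel_prod case_prod_unfold)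
  qed
  then have eq: "AE u in lborel. basic_fun \<alpha> \<rho> \<phi> \<psi> \<eta> u v w
      = complex_of_real (inverse (adm_const \<phi>)) * (\<integral>z. ?g u (fst z) (snd z) \<partial>lborel)"
    by eventually_elim (simp add: basic_fun_def)
  have [measurable]: "(\<lambda>u. \<integral>z. ?g u (fst z) (snd z) \<partial>lborel) \<in> borel_measurable lborel"
    using fub(2) by (rule borel_measurable_integrable)
  have 2: "integrable lebesgue (\<lambda>u. basic_fun \<alpha> \<rho> \<phi> \<psi> \<eta> u v w)"
    using fub(2) by (subst integrable_completion_cong_AE[OF _ eq]) auto
  have "AE u in lborel. cmod (basic_fun \<alpha> \<rho> \<phi> \<psi> \<eta> u v w)
      = inverse (adm_const \<phi>) * cmod (\<integral>z. ?g u (fst z) (snd z) \<partial>lborel)"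
    using eq by eventually_elim (use adm in \<open>simp add: norm_mult norm_inverse\<close>)
  then have "(\<integral>u. cmod (basic_fun \<alpha> \<rho> \<phi> \<psi> \<eta> u v w) \<partial>lebesgue)
      = (\<integral>u. inverse (adm_const \<phi>) * cmod (\<integral>z. ?g u (fst z) (snd z) \<partial>lborel) \<partial>lborel)"
    by (rule integral_completion_cong_AE[rotated]) simp
  also have "\<dots> \<le> inverse (adm_const \<phi>) * ?T"
    using fub(3) adm by (simp add: mult_left_mono)
  finally show ?thesis
    using 1 2 unfolding basic_fun_L1_bound_def by blast
qed

section \<open>Kernel bounds for the two ranges of \<open>\<rho>\<close>\<close>

text \<open>Passing to Borel representatives changes neither the double integral nor the norms, so
  the Borel version applies.\<close>

lemma hardy_littlewood_sobolev_Lp: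
  assumes f: "in_Lp p f" and g: "in_Lp q g"
    and pq: "1 < p" "1 < q" "0 < \<rho>" "1 / p + 1 / q = 1 + \<rho>"
  shows "(\<integral>\<^sup>+x. \<integral>\<^sup>+y. cmod (f x) * cmod (g y) * \<bar>x - y\<bar> powr (\<rho> - 1) \<partial>lborel \<partial>lborel)
    \<le> ennreal (hls_const p q \<rho> * Lp_norm p f * Lp_norm q g)"
proof -
  obtain f' where f' [measurable]: "f' \<in> borel_measurable borel" and f_eq: "AE x in lborel. f x = f' x"
    using f by (auto simp: in_Lp_def elim: borel_representative)
  obtain g' where g' [measurable]: "g' \<in> borel_measurable borel" and g_eq: "AE x in lborel. g x = g' x"
    using g by (auto simp: in_Lp_def elim: borel_representative)
  have norm_eq: "(\<integral>\<^sup>+x. cmod (h' x) powr r \<partial>lborel) = ennreal (\<integral>x. cmod (h x) powr r \<partial>lebesgue)"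
    if "in_Lp r h" "AE x in lborel. h x = h' x" for r h h'
  proof -
    have "(\<integral>\<^sup>+x. cmod (h' x) powr r \<partial>lborel) = (\<integral>\<^sup>+x. cmod (h x) powr r \<partial>lebesgue)"
      using that(2) by (subst nn_integral_completion) (auto intro!: nn_integral_cong_AE elim!: eventually_mono)
    also have "\<dots> = ennreal (\<integral>x. cmod (h x) powr r \<partial>lebesgue)"
      using that(1) by (subst nn_integral_eq_integral) (auto simp: in_Lp_def)
    finally show ?thesis .
  qed
  have "(\<integral>\<^sup>+x. \<integral>\<^sup>+y. cmod (f x) * cmod (g y) * \<bar>x - y\<bar> powr (\<rho> - 1) \<partial>lborel \<partial>lborel)
      = (\<integral>\<^sup>+x. \<integral>\<^sup>+y. cmod (f' x) * cmod (g' y) * \<bar>x - y\<bar> powr (\<rho> - 1) \<partial>lborel \<partial>lborel)"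
  proof (intro nn_integral_cong_AE, use f_eq in eventually_elim)
    case (elim x)
    then show ?case
      using g_eq by (intro nn_integral_cong_AE) (auto elim!: eventually_mono)
  qed
  also have "\<dots> \<le> ennreal (hls_const p q \<rho> * Lp_norm p f * Lp_norm q g)"
    unfolding Lp_norm_def using norm_eq[OF f f_eq] norm_eq[OF g g_eq] pq
    by (intro hardy_littlewood_sobolev) auto
  finally show ?thesis .
qed

lemma hls_const_nonneg:
  assumes "1 < p" "1 < q" "0 < \<rho>" "1 / p + 1 / q = 1 + \<rho>"
  shows "0 \<le> hls_const p q \<rho>"
  using conj_exponent_scaled_gt_1[of p q \<rho>] conj_exponent_scaled_gt_1[of q p \<rho>] assms
  by (auto simp: hls_const_def add.commute intro!: add_nonneg_nonneg)

text \<open>The distance is at most twice the larger of \<open>\<bar>x\<bar>\<close> and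
  \<open>\<bar>y\<bar>\<close>, whose power is one of the two summands. With
  \<open>s = \<rho> - 1\<close> this is the source of the constant
  \<open>2 powr (\<rho> - 1)\<close>.\<close>

lemma abs_diff_powr_le:
  fixes x y s :: real
  assumes "0 \<le> s"
  shows "\<bar>x - y\<bar> powr s \<le> 2 powr s * (\<bar>x\<bar> powr s + \<bar>y\<bar> powr s)"
proof -
  have "\<bar>x - y\<bar> powr s \<le> (2 * max \<bar>x\<bar> \<bar>y\<bar>) powr s"
    using assms by (intro powr_mono2) auto
  also have "\<dots> = 2 powr s * max \<bar>x\<bar> \<bar>y\<bar> powr s"
    by (simp add: powr_mult)
  also have "\<dots> \<le> 2 powr s * (\<bar>x\<bar> powr s + \<bar>y\<bar> powr s)"
    by (intro mult_left_mono) (auto simp: max_def)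
  finally show ?thesis .
qed

lemma in_Lp_1_iff: "in_Lp 1 f \<longleftrightarrow> integrable lebesgue f"
  by (auto simp: in_Lp_def integrable_norm_iff)

lemma Lp_norm_1: "Lp_norm 1 f = (\<integral>x. cmod (f x) \<partial>lebesgue)"
  by (simp add: Lp_norm_def)

lemma nn_integral_Lp_norm_1:
  assumes "in_Lp 1 f"
  shows "(\<integral>\<^sup>+x. cmod (f x) \<partial>lebesgue) = ennreal (Lp_norm 1 f)"
  using assms by (simp add: in_Lp_1_iff Lp_norm_1 nn_integral_eq_integral)

text \<open>The weight \<open>1 + \<bar>x\<bar> powr s\<close> dominates both \<open>1\<close> and
  \<open>\<bar>x\<bar> powr s\<close>.\<close>

lemma in_Lp_1_weight:
  assumes f: "in_Lp 1 (\<lambda>x. complex_of_real (1 + \<bar>x\<bar> powr s) * f x)"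
  shows "in_Lp 1 f" "in_Lp 1 (\<lambda>x. f x * complex_of_real (\<bar>x\<bar> powr s))"
proof -
  let ?w = "\<lambda>x. 1 + \<bar>x\<bar> powr s"
  have w: "0 < ?w x" for x by (simp add: add_pos_nonneg)
  have int: "integrable lebesgue (\<lambda>x. complex_of_real (?w x) * f x)"
    using f by (simp only: in_Lp_1_iff)
  have [measurable]: "(\<lambda>x. complex_of_real (\<bar>x\<bar> powr s)) \<in> borel_measurable lebesgue"
    by (rule measurable_completion) simp
  have "(\<lambda>x. complex_of_real (?w x)) \<in> borel_measurable lebesgue"
    by (rule measurable_completion) simp
  \<comment> \<open>Dividing by the positive weight recovers the measurability of \<open>f\<close>
    itself.\<close>
  with borel_measurable_integrable[OF int]
  have "(\<lambda>x. complex_of_real (?w x) * f x / complex_of_real (?w x)) \<in> borel_measurable lebesgue"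
    by (rule borel_measurable_divide)
  then have [measurable]: "f \<in> borel_measurable lebesgue"
    using w by (simp add: less_imp_neq[symmetric] del: of_real_add)
  show "in_Lp 1 f" "in_Lp 1 (\<lambda>x. f x * complex_of_real (\<bar>x\<bar> powr s))"
    unfolding in_Lp_1_iff
    by (rule Bochner_Integration.integrable_bound[OF int],
        use w in \<open>auto simp: norm_mult abs_of_pos mult_le_cancel_right1 mult.commute[of "cmod (f _)"]
          simp del: of_real_add intro!: mult_right_mono\<close>)+
qed

text \<open>By \<open>abs_diff_powr_le\<close> the kernel is dominated by two terms with separated
  variables, and each double integral factors into a product of two norms.\<close>

lemma weighted_kernel_bound:
  assumes f: "in_Lp 1 f" "in_Lp 1 (\<lambda>x. f x * complex_of_real (\<bar>x\<bar> powr s))"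
    and g: "in_Lp 1 g" "in_Lp 1 (\<lambda>x. g x * complex_of_real (\<bar>x\<bar> powr s))" and s: "0 \<le> s"
  shows "(\<integral>\<^sup>+x. \<integral>\<^sup>+y. cmod (f x) * cmod (g y) * \<bar>x - y\<bar> powr s \<partial>lborel \<partial>lborel)
    \<le> ennreal (2 powr s * (Lp_norm 1 (\<lambda>x. f x * complex_of_real (\<bar>x\<bar> powr s)) * Lp_norm 1 g
        + Lp_norm 1 (\<lambda>x. g x * complex_of_real (\<bar>x\<bar> powr s)) * Lp_norm 1 f))"
proof -
  let ?fs = "\<lambda>x. f x * complex_of_real (\<bar>x\<bar> powr s)" and ?gs = "\<lambda>x. g x * complex_of_real (\<bar>x\<bar> powr s)"
  define N where "N h x = ennreal (cmod (h x))" for h :: "real \<Rightarrow> complex" and x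
  have N: "N h \<in> borel_measurable lebesgue" "(\<integral>\<^sup>+x. N h x \<partial>lebesgue) = ennreal (Lp_norm 1 h)"
    if "in_Lp 1 h" for h
    using that nn_integral_Lp_norm_1[OF that] by (auto simp: N_def[abs_def] in_Lp_1_iff)
  note Nf [measurable] = N[OF f(1)] N[OF f(2)] and Ng [measurable] = N[OF g(1)] N[OF g(2)]
  have L: "0 \<le> Lp_norm 1 h" for h by (simp add: Lp_norm_def)
  \<comment> \<open>Nonnegative integrals over \<open>lborel\<close> and its completion coincide, so
    the comparison is pointwise. The right-hand side is stated over \<open>lebesgue\<close>, where
    the functions \<open>N\<close> are measurable and the product can be integrated.\<close>
  have "(\<integral>\<^sup>+x. \<integral>\<^sup>+y. cmod (f x) * cmod (g y) * \<bar>x - y\<bar> powr s \<partial>lborel \<partial>lborel)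
    \<le> (\<integral>\<^sup>+x. \<integral>\<^sup>+y. ennreal (2 powr s) * (N ?fs x * N g y + N f x * N ?gs y) \<partial>lebesgue \<partial>lebesgue)"
    unfolding nn_integral_completion
  proof (intro nn_integral_mono)
    fix x y
    have "cmod (f x) * cmod (g y) * \<bar>x - y\<bar> powr s
      \<le> cmod (f x) * cmod (g y) * (2 powr s * (\<bar>x\<bar> powr s + \<bar>y\<bar> powr s))"
      using s by (intro mult_left_mono abs_diff_powr_le) auto
    also have "\<dots> = 2 powr s * (cmod (?fs x) * cmod (g y) + cmod (f x) * cmod (?gs y))"
      by (simp add: norm_mult algebra_simps)
    finally have "ennreal (cmod (f x) * cmod (g y) * \<bar>x - y\<bar> powr s)
        \<le> ennreal (2 powr s * (cmod (?fs x) * cmod (g y) + cmod (f x) * cmod (?gs y)))"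
      by (rule ennreal_leI)
    then show "ennreal (cmod (f x) * cmod (g y) * \<bar>x - y\<bar> powr s)
      \<le> ennreal (2 powr s) * (N ?fs x * N g y + N f x * N ?gs y)"
      by (simp add: N_def ennreal_mult)
  qed
  also have "\<dots> = ennreal (2 powr s) * (ennreal (Lp_norm 1 ?fs) * ennreal (Lp_norm 1 g)
          + ennreal (Lp_norm 1 f) * ennreal (Lp_norm 1 ?gs))"
    by (simp add: nn_integral_cmult nn_integral_multc nn_integral_add Nf(2,4) Ng(2,4))
  also have "\<dots> = ennreal (2 powr s * (Lp_norm 1 ?fs * Lp_norm 1 g + Lp_norm 1 ?gs * Lp_norm 1 f))"
    using L by (simp add: ennreal_mult ennreal_plus mult.commute)
  finally show ?thesis .
qed

section \<open>The norm bounds with their explicit constants\<close>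

theorem theorem3p3:
  "\<exists>C :: real \<Rightarrow> real \<Rightarrow> real.
     \<forall>(\<alpha> :: real) (\<phi> :: real \<Rightarrow> complex).
       sin (\<alpha> * pi / 2) \<noteq> 0 \<longrightarrow>
       in_Lp 2 \<phi> \<longrightarrow>
       integrable lebesgue (\<lambda>\<omega>. (cmod (fourier \<phi> \<omega>))\<^sup>2 / \<bar>\<omega>\<bar>) \<longrightarrow>
       0 < adm_const \<phi> \<longrightarrow>
       (\<forall>(p :: real) (q :: real) (\<rho> :: real) (\<psi> :: real \<Rightarrow> complex) (\<eta> :: real \<Rightarrow> complex).
          1 < p \<longrightarrow> 1 < q \<longrightarrow> 0 < \<rho> \<longrightarrow> \<rho> < 1 \<longrightarrow> 1 / p + 1 / q = 1 + \<rho> \<longrightarrow>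
          in_Lp p \<psi> \<longrightarrow> in_Lp 1 \<phi> \<longrightarrow> in_Lp q \<eta> \<longrightarrow>
          (\<forall>v w :: real. v \<noteq> w \<longrightarrow>
             basic_fun_L1_bound \<alpha> \<rho> \<phi> \<psi> \<eta> v w
               (inverse (adm_const \<phi>) * C p \<rho> * \<bar>v - w\<bar> powr (- \<rho>)
                  * Lp_norm p \<psi> * Lp_norm 1 \<phi> * Lp_norm q \<eta>))) \<and>
       (\<forall>(\<rho> :: real) (\<psi> :: real \<Rightarrow> complex) (\<eta> :: real \<Rightarrow> complex).
          1 \<le> \<rho> \<longrightarrow> in_Lp 1 \<phi> \<longrightarrow>
          in_Lp 1 (\<lambda>x. complex_of_real (1 + \<bar>x\<bar> powr (\<rho> - 1)) * \<eta> x) \<longrightarrow>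
          in_Lp 1 (\<lambda>x. complex_of_real (1 + \<bar>x\<bar> powr (\<rho> - 1)) * \<psi> x) \<longrightarrow>
          (\<forall>v w :: real. v \<noteq> w \<longrightarrow>
             basic_fun_L1_bound \<alpha> \<rho> \<phi> \<psi> \<eta> v w
               (inverse (adm_const \<phi>) * 2 powr (\<rho> - 1) * \<bar>v - w\<bar> powr (- \<rho>)
                  * (Lp_norm 1 (\<lambda>x. \<psi> x * complex_of_real (\<bar>x\<bar> powr (\<rho> - 1))) * Lp_norm 1 \<eta>
                     + Lp_norm 1 (\<lambda>x. \<eta> x * complex_of_real (\<bar>x\<bar> powr (\<rho> - 1))) * Lp_norm 1 \<psi>)
                  * Lp_norm 1 \<phi>)))"
proof (intro exI[of _ "\<lambda>p \<rho>. hls_const p (1 / (1 + \<rho> - 1 / p)) \<rho>"] allI impI conjI)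
  fix \<alpha> \<phi> p q \<rho> \<psi> \<eta> and v w :: real
  assume adm: "0 < adm_const \<phi>" and pq: "1 < p" "1 < q" "0 < \<rho>" "1 / p + 1 / q = 1 + \<rho>"
    and \<phi>: "in_Lp 1 \<phi>" and \<psi>: "in_Lp p \<psi>" and \<eta>: "in_Lp q \<eta>" and "v \<noteq> w"
  \<comment> \<open>The exponent relation determines \<open>q\<close> from \<open>p\<close> and
    \<open>\<rho>\<close>. The witness for \<open>C\<close> is \<open>hls_const\<close> with
    \<open>q\<close> eliminated in this way, hence a function of \<open>p\<close> and
    \<open>\<rho>\<close> only.\<close>
  have "1 + \<rho> - 1 / p = 1 / q" using pq by simp
  then have q: "1 / (1 + \<rho> - 1 / p) = q" by simp
  have "basic_fun_L1_bound \<alpha> \<rho> \<phi> \<psi> \<eta> v w (inverse (adm_const \<phi>)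
      * (\<bar>v - w\<bar> powr (- \<rho>) * (hls_const p q \<rho> * Lp_norm p \<psi> * Lp_norm q \<eta>) * Lp_norm 1 \<phi>))"
    using adm \<phi> \<psi> \<eta> \<open>v \<noteq> w\<close> pq hls_const_nonneg[OF pq] hardy_littlewood_sobolev_Lp[OF \<psi> \<eta> pq]
    by (intro basic_fun_L1_boundI) (auto simp: in_Lp_def Lp_norm_def)
  then show "basic_fun_L1_bound \<alpha> \<rho> \<phi> \<psi> \<eta> v w
      (inverse (adm_const \<phi>) * hls_const p (1 / (1 + \<rho> - 1 / p)) \<rho> * \<bar>v - w\<bar> powr (- \<rho>)
        * Lp_norm p \<psi> * Lp_norm 1 \<phi> * Lp_norm q \<eta>)"
    unfolding q by (simp add: mult_ac)
next
  fix \<alpha> \<phi> \<rho> \<psi> \<eta> and v w :: real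
  assume adm: "0 < adm_const \<phi>" and \<rho>: "1 \<le> \<rho>" and \<phi>: "in_Lp 1 \<phi>"
    and \<eta>: "in_Lp 1 (\<lambda>x. complex_of_real (1 + \<bar>x\<bar> powr (\<rho> - 1)) * \<eta> x)"
    and \<psi>: "in_Lp 1 (\<lambda>x. complex_of_real (1 + \<bar>x\<bar> powr (\<rho> - 1)) * \<psi> x)" and "v \<noteq> w"
  let ?N = "Lp_norm 1 (\<lambda>x. \<psi> x * complex_of_real (\<bar>x\<bar> powr (\<rho> - 1))) * Lp_norm 1 \<eta>
     + Lp_norm 1 (\<lambda>x. \<eta> x * complex_of_real (\<bar>x\<bar> powr (\<rho> - 1))) * Lp_norm 1 \<psi>"
  note \<psi>' = in_Lp_1_weight[OF \<psi>] and \<eta>' = in_Lp_1_weight[OF \<eta>]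
  have "0 \<le> 2 powr (\<rho> - 1) * ?N" by (simp add: Lp_norm_def)
  then have "basic_fun_L1_bound \<alpha> \<rho> \<phi> \<psi> \<eta> v w
      (inverse (adm_const \<phi>) * (\<bar>v - w\<bar> powr (- \<rho>) * (2 powr (\<rho> - 1) * ?N) * Lp_norm 1 \<phi>))"
    using adm \<phi> \<psi>'(1) \<eta>'(1) \<open>v \<noteq> w\<close> \<rho> weighted_kernel_bound[OF \<psi>' \<eta>']
    by (intro basic_fun_L1_boundI) (auto simp: in_Lp_def)
  then show "basic_fun_L1_bound \<alpha> \<rho> \<phi> \<psi> \<eta> v w
      (inverse (adm_const \<phi>) * 2 powr (\<rho> - 1) * \<bar>v - w\<bar> powr (- \<rho>) * ?N * Lp_norm 1 \<phi>)"
    by (simp add: mult_ac)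
qed

end
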